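(* Let $G$ be a connected simple subcubic graph different from $K_2$. If the set of all vertices of degree three in $G$ is an independent set, then $\operatorname{lir}(^2G) \leq 2$.
   Context: All graphs are finite and without loops. A graph is subcubic if its maximum degree is at most three. A multigraph $M$ consists of a nonempty finite vertex set and a multiset of edges (2-element subsets of the vertex set); the degree of a vertex is the sum of the multiplicities of the edges incident to it. For a simple graph $G$, $^2G$ denotes the 2-multigraph obtained from $G$ by replacing each edge of $G$ with two parallel edges. A multigraph is locally irregular if every two adjacent vertices have different degrees. An edge coloring of a multigraph $M$ assigns a color to each element of the edge multiset (it need not be proper, and parallel edges may receive different colors); it is locally irregular if, for each color, the submultigraph of $M$ induced by the edges of that color is locally irregular. The locally irregular chromatic index $\operatorname{lir}(M)$ is the smallest number of colors in a locally irregular edge coloring of $M$, if one exists; so $\operatorname{lir}(M)\leq k$ means that $M$ has a locally irregular edge coloring using at most $k$ colors. *)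

theory Defs
  imports "HOL-Library.Multiset" "HOL-Library.Extended_Nat"
begin

record 'a sgraph =
  verts :: "'a set"
  edges :: "'a set set"

definition simple_graph :: "'a sgraph \<Rightarrow> bool" where
  "simple_graph G \<longleftrightarrow>
     finite (verts G) \<and> verts G \<noteq> {} \<and>
     (\<forall>e\<in>edges G. e \<subseteq> verts G \<and> card e = 2)"

definition degree :: "'a sgraph \<Rightarrow> 'a \<Rightarrow> nat" where
  "degree G v = card {e \<in> edges G. v \<in> e}"

definition max_degree :: "'a sgraph \<Rightarrow> nat" where
  "max_degree G = Max (degree G ` verts G)"

definition subcubic :: "'a sgraph \<Rightarrow> bool" where
  "subcubic G \<longleftrightarrow> max_degree G \<le> 3"

definition connected_graph :: "'a sgraph \<Rightarrow> bool" where
  "connected_graph G \<longleftrightarrow>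
     (\<forall>u\<in>verts G. \<forall>v\<in>verts G. (u, v) \<in> {(x, y). {x, y} \<in> edges G}\<^sup>*)"

text \<open>\<open>G\<close> is (isomorphic to) the complete graph on \<open>n\<close> vertices.\<close>
definition is_complete_graph :: "nat \<Rightarrow> 'a sgraph \<Rightarrow> bool" where
  "is_complete_graph n G \<longleftrightarrow>
     card (verts G) = n \<and> edges G = {e. e \<subseteq> verts G \<and> card e = 2}"

definition independent_set :: "'a sgraph \<Rightarrow> 'a set \<Rightarrow> bool" where
  "independent_set G S \<longleftrightarrow> S \<subseteq> verts G \<and> (\<forall>u\<in>S. \<forall>v\<in>S. {u, v} \<notin> edges G)"

record 'a multigraph =
  mverts :: "'a set"
  medges :: "'a set multiset"

definition is_multigraph :: "'a multigraph \<Rightarrow> bool" where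
  "is_multigraph M \<longleftrightarrow>
     finite (mverts M) \<and> mverts M \<noteq> {} \<and>
     (\<forall>e\<in>#medges M. e \<subseteq> mverts M \<and> card e = 2)"

definition double :: "'a sgraph \<Rightarrow> 'a multigraph" where
  "double G = \<lparr>mverts = verts G, medges = repeat_mset 2 (mset_set (edges G))\<rparr>"

definition mdegree :: "'a multigraph \<Rightarrow> 'a \<Rightarrow> nat" where
  "mdegree M v = (\<Sum>e\<in>{e \<in> set_mset (medges M). v \<in> e}. count (medges M) e)"

definition locally_irregular :: "'a multigraph \<Rightarrow> bool" where
  "locally_irregular M \<longleftrightarrow>
     (\<forall>u\<in>mverts M. \<forall>v\<in>mverts M. {u, v} \<in># medges M \<longrightarrow> mdegree M u \<noteq> mdegree M v)"

text \<open>The \<open>m\<close> parallel copies of an edge \<open>e\<close> of multiplicity \<open>m\<close> are distinguished as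
  \<open>(e, 0), \<dots>, (e, m - 1)\<close>, so that they can receive different colors. An edge coloring is any
  function into the colors; only its values on \<open>edge_copies M\<close> matter.\<close>
definition edge_copies :: "'a multigraph \<Rightarrow> ('a set \<times> nat) set" where
  "edge_copies M = (SIGMA e:set_mset (medges M). {..<count (medges M) e})"

definition color_submultigraph :: "'a multigraph \<Rightarrow> ('a set \<times> nat \<Rightarrow> nat) \<Rightarrow> nat \<Rightarrow> 'a multigraph" where
  "color_submultigraph M c i =
     (let F = image_mset fst (mset_set {x \<in> edge_copies M. c x = i})
      in \<lparr>mverts = \<Union> (set_mset F), medges = F\<rparr>)"

definition colors_used :: "'a multigraph \<Rightarrow> ('a set \<times> nat \<Rightarrow> nat) \<Rightarrow> nat set" where
  "colors_used M c = c ` edge_copies M"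

definition locally_irregular_coloring :: "'a multigraph \<Rightarrow> ('a set \<times> nat \<Rightarrow> nat) \<Rightarrow> bool" where
  "locally_irregular_coloring M c \<longleftrightarrow>
     (\<forall>i\<in>colors_used M c. locally_irregular (color_submultigraph M c i))"

text \<open>\<open>lir M = \<infinity>\<close> iff \<open>M\<close> has no locally irregular edge coloring.\<close>
definition lir :: "'a multigraph \<Rightarrow> enat" where
  "lir M = (INF c\<in>{c. locally_irregular_coloring M c}. enat (card (colors_used M c)))"

lemma is_multigraph_double:
  assumes "simple_graph G"
  shows "is_multigraph (double G)"
proof -
  have "edges G \<subseteq> Pow (verts G)" using assms by (auto simp: simple_graph_def)
  then have fin: "finite (edges G)"
    using assms by (meson finite_Pow_iff finite_subset simple_graph_def)
  have "set_mset (repeat_mset 2 (mset_set (edges G))) = edges G"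
    using fin by (intro set_eqI) (simp flip: count_greater_zero_iff add: count_mset_set')
  then show ?thesis
    using assms by (auto simp: is_multigraph_def double_def simple_graph_def)
qed

lemma lir_le_iff:
  "lir M \<le> enat k \<longleftrightarrow> (\<exists>c. locally_irregular_coloring M c \<and> card (colors_used M c) \<le> k)"
proof
  assume le: "lir M \<le> enat k"
  let ?A = "(\<lambda>c. enat (card (colors_used M c))) ` {c. locally_irregular_coloring M c}"
  have "?A \<noteq> {}"
  proof
    assume "?A = {}"
    then have "lir M = Inf {}" unfolding lir_def by (rule arg_cong)
    with le show False by (simp add: Inf_enat_def)
  qed
  then obtain x where "x \<in> ?A" by blast
  then have "Inf ?A \<in> ?A" by (rule wellorder_InfI)
  then obtain c where c: "locally_irregular_coloring M c"
      and "Inf ?A = enat (card (colors_used M c))" by blast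
  then have "lir M = enat (card (colors_used M c))" by (simp only: lir_def)
  with le have "card (colors_used M c) \<le> k" by simp
  with c show "\<exists>c. locally_irregular_coloring M c \<and> card (colors_used M c) \<le> k" by blast
next
  assume "\<exists>c. locally_irregular_coloring M c \<and> card (colors_used M c) \<le> k"
  then obtain c where c: "locally_irregular_coloring M c" "card (colors_used M c) \<le> k" by blast
  then have "lir M \<le> enat (card (colors_used M c))" unfolding lir_def by (intro INF_lower) auto
  then show "lir M \<le> enat k" using c(2) by (simp add: order_trans)
qed

end

theory Submission
  imports Defs
begin

text \<open>Encode a two-coloring of the doubled graph by labels \<open>Y e \<in> {-1, 0, 1}\<close>, where \<open>1 + Y e\<close> copies
  of \<open>e\<close> are red and \<open>1 - Y e\<close> are blue. An edge \<open>m\<close> between two vertices of degree 2 is fine iff its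
  two neighbouring edges have different labels (they are in conflict). If a vertex of degree 3 has
  labels \<open>s, s, s\<close> with \<open>s = 1\<close> or \<open>s = -1\<close>, then its incident edges are fine whatever the other
  labels are; with labels \<open>s, s, 0\<close> only the edge labelled 0 needs care, and it is fine if it
  continues through a vertex of degree 2 into an edge labelled 0. Each edge at a vertex of degree 3
  is in conflict with at most one edge, so the vertices of degree 3 can be treated one after the
  other: one of the two signs \<open>s\<close> is forbidden on at most one of the three edges, and that edge gets
  the label 0. The middle edge of such a conflict has no conflicts itself, hence may be labelled 0.

  A pendant edge at a vertex of degree 2 copies the label of the next edge. Identified in this way,
  each remaining edge still has at most two conflicts, so three labels suffice for a greedy choice.\<close>

section \<open>Greedy labellings\<close>

text \<open>Treats one more vertex of degree 3: \<open>S\<close> is its star, and \<open>N\<close>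
  holds the edges already labelled by \<open>y\<close>. A zero is allowed only on an edge that has a
  conflict, because that conflict later forces the label of the next edge.\<close>

lemma star_labelling_step:
  fixes Q :: "'e \<Rightarrow> 'e \<Rightarrow> bool" and y :: "'e \<Rightarrow> int"
  assumes card3: "card S = 3"
    and disj: "S \<inter> N = {}"
    and sym: "\<And>e f. Q e f \<Longrightarrow> Q f e"
    and irrefl: "\<And>e. \<not> Q e e"
    and fn: "\<And>e f f'. e \<in> S \<Longrightarrow> Q e f \<Longrightarrow> Q e f' \<Longrightarrow> f = f'"
  obtains x s where "s \<in> {1,-1::int}"
    "\<forall>e\<in>S. x e = s \<or> (x e = 0 \<and> (\<exists>f\<in>S \<union> N. Q e f))"
    "\<forall>e\<in>S. \<forall>f\<in>S. x e = 0 \<longrightarrow> x f = 0 \<longrightarrow> e = f"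
    "\<forall>e\<in>S. \<forall>f\<in>S. Q e f \<longrightarrow> x e \<noteq> x f"
    "\<forall>e\<in>S. \<forall>f\<in>N. Q e f \<longrightarrow> x e \<noteq> y f"
proof (cases "\<exists>e\<in>S. \<exists>f\<in>S. Q e f")
  case True
  then obtain e f where ef: "e \<in> S" "f \<in> S" "Q e f" by blast
  then have "e \<noteq> f" using irrefl by blast
  then have "card (S - {e, f}) = 1" using ef card3 by (simp add: card_Diff_subset)
  then obtain g where g: "S - {e, f} = {g}" by (auto simp: card_1_singleton_iff)
  have st: "S = {e, f, g}" "g \<noteq> e" "g \<noteq> f" using g ef by auto
  have Qe: "Q e b \<Longrightarrow> b = f" for b using fn ef by blast
  have Qf: "Q f b \<Longrightarrow> b = e" for b using fn ef sym by blast
  have Qg: "Q g b \<Longrightarrow> b \<notin> S" for b using Qe Qf sym irrefl st by blast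
  \<comment> \<open>The edges \<open>e\<close> and \<open>f\<close> have only each other as
    conflicts, so 0 on \<open>e\<close> settles these for either sign. The sign has to suit only the
    possible conflict of \<open>g\<close>.\<close>
  obtain s where s: "s \<in> {1,-1::int}" "\<And>h. Q g h \<Longrightarrow> y h \<noteq> s"
  proof (cases "\<exists>h. Q g h \<and> y h = 1")
    case True
    then have "\<And>h. Q g h \<Longrightarrow> y h = 1" using fn[of g] st(1) by blast
    then show ?thesis by (intro that[of "-1"]) auto
  next
    case False
    then show ?thesis by (intro that[of 1]) auto
  qed
  have "s \<noteq> 0" using s by auto
  show ?thesis
  proof (rule that[of s "\<lambda>a. if a = e then 0 else s"])
    show "\<forall>a\<in>S. \<forall>b\<in>S. Q a b \<longrightarrow> (if a = e then 0 else s) \<noteq> (if b = e then 0 else s)"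
    proof (intro ballI impI)
      fix a b assume "a \<in> S" "b \<in> S" "Q a b"
      then have "a = e \<and> b = f \<or> a = f \<and> b = e" using Qe Qf Qg st(1) by blast
      then show "(if a = e then 0 else s) \<noteq> (if b = e then 0 else s)"
        using \<open>s \<noteq> 0\<close> \<open>e \<noteq> f\<close> by auto
    qed
    show "\<forall>a\<in>S. \<forall>b\<in>N. Q a b \<longrightarrow> (if a = e then 0 else s) \<noteq> y b"
    proof (intro ballI impI)
      fix a b assume ab: "a \<in> S" "b \<in> N" "Q a b"
      then have "a = g" using Qe Qf st(1) disj ef(1,2) by blast
      then show "(if a = e then 0 else s) \<noteq> y b"
        using s(2)[of b] ab(3) st(2) by auto
    qed
  qed (use s(1) \<open>s \<noteq> 0\<close> ef in auto)
next
  case False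
  define bad where "bad s e \<longleftrightarrow> (\<exists>f\<in>N. Q e f \<and> y f = s)" for s e
  have b: "\<not> (bad 1 e \<and> bad (-1) e)" if "e \<in> S" for e
  proof
    assume "bad 1 e \<and> bad (-1) e"
    then obtain f f' where "Q e f" "y f = 1" "Q e f'" "y f' = -1" unfolding bad_def by blast
    then show False using fn[OF that, of f f'] by simp
  qed
  obtain p q r where pqr: "S = {p, q, r}"
    using card3 by (metis card_3_iff)
  \<comment> \<open>No edge is bad for both signs, so among three edges one of the signs is bad for
    at most one edge.\<close>
  obtain s where s: "s \<in> {1,-1::int}"
    "\<And>e f. e \<in> S \<Longrightarrow> f \<in> S \<Longrightarrow> bad s e \<Longrightarrow> bad s f \<Longrightarrow> e = f"
  proof (cases "\<forall>e\<in>S. \<forall>f\<in>S. bad 1 e \<longrightarrow> bad 1 f \<longrightarrow> e = f")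
    case True
    then show ?thesis by (intro that[of 1]) auto
  next
    case False
    then obtain e f where ef: "e \<in> S" "f \<in> S" "bad 1 e" "bad 1 f" "e \<noteq> f" by blast
    then have "\<not> bad (-1) e" "\<not> bad (-1) f" using b by blast+
    then have "\<And>e' f'. e' \<in> S \<Longrightarrow> f' \<in> S \<Longrightarrow> bad (-1) e' \<Longrightarrow> bad (-1) f' \<Longrightarrow> e' = f'"
      using ef(1,2,5) unfolding pqr by blast
    then show ?thesis by (intro that[of "-1"]) auto
  qed
  have "s \<noteq> 0" using s by auto
  show ?thesis
  \<comment> \<open>The label 0 suits a bad edge: its only conflict has the label \<open>s\<close>,
    which is not 0.\<close>
  proof (rule that[of s "\<lambda>a. if bad s a then 0 else s"])
    show "\<forall>a\<in>S. \<forall>b\<in>N. Q a b \<longrightarrow> (if bad s a then 0 else s) \<noteq> y b"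
    proof (intro ballI impI)
      fix a b assume ab: "a \<in> S" "b \<in> N" "Q a b"
      show "(if bad s a then 0 else s) \<noteq> y b"
      proof (cases "bad s a")
        case True
        then obtain c where "Q a c" "y c = s" unfolding bad_def by blast
        then have "y b = s" using fn ab by blast
        then show ?thesis using True \<open>s \<noteq> 0\<close> by simp
      next
        case False
        then show ?thesis using ab unfolding bad_def by auto
      qed
    qed
    show "\<forall>e\<in>S. (if bad s e then 0 else s) = s \<or> (if bad s e then 0 else s) = 0 \<and> (\<exists>f\<in>S \<union> N. Q e f)"
      unfolding bad_def by auto
    show "\<forall>e\<in>S. \<forall>f\<in>S. Q e f \<longrightarrow> (if bad s e then 0 else s) \<noteq> (if bad s f then 0 else s)"
      using False by blast
    show "\<forall>e\<in>S. \<forall>f\<in>S. (if bad s e then 0 else s) = 0 \<longrightarrow> (if bad s f then 0 else s) = 0 \<longrightarrow> e = f"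
      using s(2) \<open>s \<noteq> 0\<close> by simp
  qed (fact s(1))
qed

text \<open>Induction over the vertices of degree 3. As the stars are disjoint, a new star is
  labelled without touching the old ones, and the conflict that justifies an old zero still lies in
  the larger union.\<close>

lemma star_labelling:
  fixes Q :: "'e \<Rightarrow> 'e \<Rightarrow> bool" and star :: "'v \<Rightarrow> 'e set"
  assumes "finite T"
    and "\<And>v. v \<in> T \<Longrightarrow> card (star v) = 3"
    and "\<And>v w. v \<in> T \<Longrightarrow> w \<in> T \<Longrightarrow> v \<noteq> w \<Longrightarrow> star v \<inter> star w = {}"
    and sym: "\<And>e f. Q e f \<Longrightarrow> Q f e"
    and irrefl: "\<And>e. \<not> Q e e"
    and "\<And>v e f f'. v \<in> T \<Longrightarrow> e \<in> star v \<Longrightarrow> Q e f \<Longrightarrow> Q e f' \<Longrightarrow> f = f'"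
  shows "\<exists>y :: 'e \<Rightarrow> int.
    (\<forall>v\<in>T. \<exists>s\<in>{1,-1}. (\<forall>e\<in>star v. y e = s \<or> (y e = 0 \<and> (\<exists>f\<in>\<Union>(star ` T). Q e f))) \<and>
        (\<forall>e\<in>star v. \<forall>f\<in>star v. y e = 0 \<longrightarrow> y f = 0 \<longrightarrow> e = f)) \<and>
    (\<forall>e\<in>\<Union>(star ` T). \<forall>f\<in>\<Union>(star ` T). Q e f \<longrightarrow> y e \<noteq> y f)"
  using assms(1,2,3,6)
proof (induction T rule: finite_induct)
  case empty
  then show ?case by simp
next
  case (insert v T)
  let ?N = "\<Union>(star ` T)"
  let ?ok = "\<lambda>y N w. \<exists>s\<in>{1,-1::int}. (\<forall>e\<in>star w. y e = s \<or> (y e = 0 \<and> (\<exists>f\<in>N. Q e f))) \<and>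
        (\<forall>e\<in>star w. \<forall>f\<in>star w. y e = 0 \<longrightarrow> y f = 0 \<longrightarrow> e = f)"
  have card3: "card (star v) = 3" by (rule insert.prems(1)) simp
  have disj: "star v \<inter> ?N = {}"
    using insert.prems(2)[of v] insert.hyps by blast
  have fn: "f = f'" if "e \<in> star v" "Q e f" "Q e f'" for e f f'
    using insert.prems(3)[of v] that by blast
  have "\<exists>y :: 'e \<Rightarrow> int. (\<forall>w\<in>T. ?ok y ?N w) \<and> (\<forall>e\<in>?N. \<forall>f\<in>?N. Q e f \<longrightarrow> y e \<noteq> y f)"
  proof (rule insert.IH)
    show "\<And>w e f f'. w \<in> T \<Longrightarrow> e \<in> star w \<Longrightarrow> Q e f \<Longrightarrow> Q e f' \<Longrightarrow> f = f'"
      using insert.prems(3) by blast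
    show "\<And>w. w \<in> T \<Longrightarrow> card (star w) = 3"
      using insert.prems(1) by blast
    show "\<And>w u. w \<in> T \<Longrightarrow> u \<in> T \<Longrightarrow> w \<noteq> u \<Longrightarrow> star w \<inter> star u = {}"
      by (rule insert.prems(2)) simp_all
  qed
  then obtain y :: "'e \<Rightarrow> int" where
    y1: "\<forall>w\<in>T. ?ok y ?N w"
    and y2: "\<forall>e\<in>?N. \<forall>f\<in>?N. Q e f \<longrightarrow> y e \<noteq> y f"
    by (elim exE conjE) (rule that)
  obtain x s where x: "s \<in> {1,-1::int}"
      "\<forall>e\<in>star v. x e = s \<or> (x e = 0 \<and> (\<exists>f\<in>star v \<union> ?N. Q e f))"
      "\<forall>e\<in>star v. \<forall>f\<in>star v. x e = 0 \<longrightarrow> x f = 0 \<longrightarrow> e = f"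
      "\<forall>e\<in>star v. \<forall>f\<in>star v. Q e f \<longrightarrow> x e \<noteq> x f"
      "\<forall>e\<in>star v. \<forall>f\<in>?N. Q e f \<longrightarrow> x e \<noteq> y f"
    by (rule star_labelling_step[of "star v" ?N Q y, OF card3 disj sym irrefl fn])
  define y' where "y' e = (if e \<in> star v then x e else y e)" for e
  have y'v: "y' e = x e" if "e \<in> star v" for e using that by (simp add: y'_def)
  have y'w: "y' e = y e" if "e \<in> ?N" for e using that disj by (auto simp: y'_def)
  have A: "?ok y' (star v \<union> ?N) w" if "w \<in> insert v T" for w
  proof (cases "w = v")
    case True
    show ?thesis by (rule bexI[of _ s]) (use x(1-3) True y'v in simp_all)
  next
    case False
    then have w: "w \<in> T" using that by simp
    then have "y' e = y e" if "e \<in> star w" for e using y'w that by blast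
    moreover obtain s where "s \<in> {1,-1}" "\<forall>e\<in>star w. y e = s \<or> (y e = 0 \<and> (\<exists>f\<in>?N. Q e f))"
      "\<forall>e\<in>star w. \<forall>f\<in>star w. y e = 0 \<longrightarrow> y f = 0 \<longrightarrow> e = f"
      using bspec[OF y1 w] by (elim bexE conjE) (rule that)
    ultimately show ?thesis by (intro bexI[of _ s]) (simp_all, blast)
  qed
  have B: "y' e \<noteq> y' f" if mem: "e \<in> star v \<union> ?N" "f \<in> star v \<union> ?N" "Q e f" for e f
  proof -
    consider "e \<in> star v" "f \<in> star v" | "e \<in> star v" "f \<in> ?N" | "e \<in> ?N" "f \<in> star v" | "e \<in> ?N" "f \<in> ?N"
      using mem(1,2) by blast
    then show ?thesis
    proof cases
      case 1
      then show ?thesis using x(4) y'v mem by simp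
    next
      case 2
      then show ?thesis using x(5)[rule_format, OF 2 mem(3)] y'v[OF 2(1)] y'w[OF 2(2)] by argo
    next
      case 3
      then show ?thesis using x(5)[rule_format, OF 3(2,1) sym[OF mem(3)]] y'v[OF 3(2)] y'w[OF 3(1)] by argo
    next
      case 4
      then show ?thesis using y2[rule_format, OF 4 mem(3)] y'w[OF 4(1)] y'w[OF 4(2)] by argo
    qed
  qed
  have U: "\<Union>(star ` insert v T) = star v \<union> ?N" by simp
  have "\<forall>w\<in>insert v T. ?ok y' (star v \<union> ?N) w" using A by (rule ballI)
  moreover have "\<forall>e\<in>star v \<union> ?N. \<forall>f\<in>star v \<union> ?N. Q e f \<longrightarrow> y' e \<noteq> y' f"
    by (intro ballI impI) (rule B)
  ultimately show ?case unfolding U by (intro exI[of _ y'] conjI)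
qed

text \<open>At most two of the three values are excluded for each new element. Since
  \<open>f\<close> is unrestricted in the conclusion, conflicts with the prescribed labels outside
  \<open>F\<close> are avoided too.\<close>

lemma greedy_3_coloring_extension:
  fixes y0 :: "'e \<Rightarrow> int"
  assumes "finite F"
    and sym: "\<And>e f. Q e f \<Longrightarrow> Q f e"
    and irrefl: "\<And>e. \<not> Q e e"
    and "\<And>e. e \<in> F \<Longrightarrow> \<exists>a b. \<forall>f. Q e f \<longrightarrow> f = a \<or> f = b"
  shows "\<exists>y. (\<forall>e. e \<notin> F \<longrightarrow> y e = y0 e) \<and> (\<forall>e\<in>F. y e \<in> {-1,0,1}) \<and>
    (\<forall>e\<in>F. \<forall>f. Q e f \<longrightarrow> y e \<noteq> y f)"
  using assms(1,4)
proof (induction F rule: finite_induct)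
  case empty
  then show ?case by auto
next
  case (insert e F)
  have "\<exists>y. (\<forall>e. e \<notin> F \<longrightarrow> y e = y0 e) \<and> (\<forall>e\<in>F. y e \<in> {-1,0,1}) \<and>
    (\<forall>e\<in>F. \<forall>f. Q e f \<longrightarrow> y e \<noteq> y f)"
    using insert.prems by (intro insert.IH) blast
  then obtain y where y: "\<And>e. e \<notin> F \<Longrightarrow> y e = y0 e" "\<And>e. e \<in> F \<Longrightarrow> y e \<in> {-1,0,1}"
    "\<And>e f. e \<in> F \<Longrightarrow> Q e f \<Longrightarrow> y e \<noteq> y f" by blast
  obtain a b where ab: "\<And>f. Q e f \<Longrightarrow> f = a \<or> f = b" using insert.prems[of e] by auto
  have "\<exists>c\<in>{-1,0,1::int}. c \<noteq> y a \<and> c \<noteq> y b" by auto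
  then obtain c where c: "c \<in> {-1,0,1}" "c \<noteq> y a" "c \<noteq> y b" by blast
  have ce: "c \<noteq> y f" if "Q e f" for f using ab[OF that] c by auto
  have "(y(e := c)) g \<noteq> (y(e := c)) f" if "g \<in> insert e F" "Q g f" for g f
    using that ce irrefl y(3)[of g f] sym[OF that(2)] by (cases "g = e"; cases "f = e") (auto dest: ce)
  then show ?case
    by (intro exI[of _ "y(e := c)"]) (use y(1,2) c(1) in simp)
qed

section \<open>Conflicts in subcubic graphs\<close>

text \<open>The last assumption excludes both adjacent vertices of degree 3 and components \<open>K\<^sub>2\<close>.\<close>

locale independent_cubic =
  fixes E :: "'a set set"
  assumes finite_E: "finite E"
    and card_E: "e \<in> E \<Longrightarrow> card e = 2"
    and degree_le: "card {e \<in> E. v \<in> e} \<le> 3"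
    and equal_degrees: "e \<in> E \<Longrightarrow> u \<in> e \<Longrightarrow> v \<in> e \<Longrightarrow> u \<noteq> v \<Longrightarrow>
      card {e \<in> E. u \<in> e} = card {e \<in> E. v \<in> e} \<Longrightarrow> card {e \<in> E. u \<in> e} = 2"
begin

definition star :: "'a \<Rightarrow> 'a set set" where
  "star v = {e \<in> E. v \<in> e}"

definition next_edge :: "'a \<Rightarrow> 'a set \<Rightarrow> 'a set \<Rightarrow> bool" where
  "next_edge x e f \<longleftrightarrow> card (star x) = 2 \<and> e \<in> star x \<and> f \<in> star x \<and> e \<noteq> f"

text \<open>The condition \<open>x \<noteq> z\<close> keeps the path from turning back, so
  \<open>m\<close> joins two vertices of degree 2. In either color, their degrees can differ only
  through the labels of \<open>e\<close> and \<open>f\<close>.\<close>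

definition conflict :: "'a set \<Rightarrow> 'a set \<Rightarrow> bool" where
  "conflict e f \<longleftrightarrow> (\<exists>x z m. next_edge x e m \<and> next_edge z m f \<and> x \<noteq> z)"

definition pendant :: "'a set \<Rightarrow> bool" where
  "pendant e \<longleftrightarrow> (\<exists>v\<in>e. card (star v) = 1)"

text \<open>In the paths with three and with four vertices, a pendant edge is not merged with the next edge
  \<open>e\<close>: its two pendant edges may have to differ. In these cases \<open>e\<close> has no conflict and gets the
  label 0, which is compatible with every label of the pendant edges.\<close>

definition merges :: "'a set \<Rightarrow> 'a set \<Rightarrow> bool" where
  "merges g e \<longleftrightarrow> pendant g \<and> \<not> pendant e \<and>
     (\<exists>x. next_edge x g e \<and> (\<forall>z h. z \<noteq> x \<longrightarrow> next_edge z e h \<longrightarrow> \<not> pendant h))"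

text \<open>The choice is unambiguous by \<open>merges_unique\<close>. The target of a merge is not
  pendant, hence it is its own representative.\<close>

definition rep :: "'a set \<Rightarrow> 'a set" where
  "rep g = (if \<exists>e. merges g e then SOME e. merges g e else g)"

text \<open>The conflicts after merged edges have been identified; the greedy labelling takes place
  in this quotient.\<close>

definition rep_conflict :: "'a set \<Rightarrow> 'a set \<Rightarrow> bool" where
  "rep_conflict a b \<longleftrightarrow> (\<exists>g h. conflict g h \<and> a = rep g \<and> b = rep h)"

section \<open>Paths through vertices of degree 2\<close>

lemma star_iff: "e \<in> star v \<longleftrightarrow> e \<in> E \<and> v \<in> e"
  by (simp add: star_def)

lemma edge_eqI: "e \<in> E \<Longrightarrow> f \<in> E \<Longrightarrow> x \<in> e \<Longrightarrow> z \<in> e \<Longrightarrow> x \<in> f \<Longrightarrow> z \<in> f \<Longrightarrow> x \<noteq> z \<Longrightarrow> e = f"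
  using card_E[of e] card_E[of f] by (auto simp: card_2_iff)

lemma edge_two: "e \<in> E \<Longrightarrow> x \<in> e \<Longrightarrow> z \<in> e \<Longrightarrow> w \<in> e \<Longrightarrow> x \<noteq> z \<Longrightarrow> w = x \<or> w = z"
  using card_E[of e] by (auto simp: card_2_iff)

lemma next_edge_sym: "next_edge x e f \<Longrightarrow> next_edge x f e"
  by (auto simp: next_edge_def)

lemma next_edge_unique: "next_edge x e f \<Longrightarrow> next_edge x e f' \<Longrightarrow> f = f'"
  by (auto simp: next_edge_def card_2_iff)

lemma next_edge_mem: "next_edge x e f \<Longrightarrow> e \<in> E \<and> f \<in> E \<and> x \<in> e \<and> x \<in> f \<and> e \<noteq> f \<and> card (star x) = 2"
  by (auto simp: next_edge_def star_iff)

lemma star_next_edge: "next_edge x e f \<Longrightarrow> star x = {e, f}"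
  by (auto simp: next_edge_def card_2_iff)

lemma conflict_sym: "conflict e f \<Longrightarrow> conflict f e"
  unfolding conflict_def by (metis next_edge_sym)

text \<open>An edge in conflict with itself would share both \<open>x\<close> and \<open>z\<close>
  with the middle edge and thus coincide with it.\<close>

lemma conflict_irrefl: "\<not> conflict e e"
  unfolding conflict_def by (metis next_edge_mem edge_eqI)

lemma conflict_mem: "conflict e f \<Longrightarrow> e \<in> E \<and> f \<in> E"
  unfolding conflict_def by (metis next_edge_mem)

text \<open>The vertex \<open>x\<close> fixes the middle edge, whose other end is \<open>z\<close>,
  and there again only one edge continues.\<close>

lemma conflict_through_unique:
  assumes "next_edge x e m" "next_edge z m f" "x \<noteq> z" "next_edge x e m'" "next_edge z' m' f'" "x \<noteq> z'"
  shows "f = f'"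
  using assms by (metis next_edge_unique next_edge_mem edge_two)

text \<open>Every conflict of \<open>e\<close> leaves through a vertex of degree 2, which can only
  be the end other than \<open>v\<close>.\<close>

lemma conflict_unique_cubic:
  assumes "v \<in> e" "card (star v) = 3" "conflict e f" "conflict e f'"
  shows "f = f'"
proof -
  obtain x z m where 1: "next_edge x e m" "next_edge z m f" "x \<noteq> z"
    using assms unfolding conflict_def by blast
  obtain x' z' m' where 2: "next_edge x' e m'" "next_edge z' m' f'" "x' \<noteq> z'"
    using assms unfolding conflict_def by blast
  have "x \<noteq> v" "x' \<noteq> v" using 1 2 assms(2) by (auto simp: next_edge_def)
  then have "x = x'" using 1 2 assms(1) by (metis edge_two next_edge_mem)
  then show ?thesis using 1 2 conflict_through_unique by blast
qed

section \<open>Pendant edges and their representatives\<close>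

lemma pendant_next_unique:
  assumes "pendant g" "next_edge x g e" "next_edge x' g e'"
  shows "x = x'" "e = e'"
proof -
  obtain v where v: "v \<in> g" "card (star v) = 1" using assms(1) by (auto simp: pendant_def)
  then have "v \<noteq> x" "v \<noteq> x'" using assms by (auto simp: next_edge_def)
  then show "x = x'" using assms v by (metis edge_two next_edge_mem)
  then show "e = e'" using assms next_edge_unique by blast
qed

lemma merges_unique: "merges g e \<Longrightarrow> merges g e' \<Longrightarrow> e = e'"
  unfolding merges_def by (metis pendant_next_unique(2))

lemma rep_eq: "merges g e \<Longrightarrow> rep g = e"
  unfolding rep_def using merges_unique by (metis someI)

lemma rep_cases:
  obtains "rep g = g" "\<And>e. \<not> merges g e" | "merges g (rep g)"
  unfolding rep_def by (metis someI)

lemma rep_merges: "rep g = a \<Longrightarrow> g = a \<or> merges g a"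
  by (cases g rule: rep_cases) auto

lemma rep_not_pendant: "\<not> pendant e \<Longrightarrow> rep e = e"
  unfolding rep_def merges_def by auto

lemma rep_conflict_sym: "rep_conflict a b \<Longrightarrow> rep_conflict b a"
  unfolding rep_conflict_def using conflict_sym by blast

text \<open>The only edge following the pendant edge \<open>g\<close> is \<open>e\<close>, so
  \<open>e\<close> would be both the middle and the last edge of the conflict.\<close>

lemma merges_conflict_False:
  assumes "merges g e" "conflict g e" shows False
proof -
  obtain x where x: "next_edge x g e" "pendant g" using assms by (auto simp: merges_def)
  obtain x' z m where c: "next_edge x' g m" "next_edge z m e" using assms by (auto simp: conflict_def)
  show False using pendant_next_unique(2)[OF x(2) x(1) c(1)] next_edge_mem[OF c(2)] by simp
qed

text \<open>A second pendant edge at the other end of \<open>e\<close> would violate the last clause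
  of \<open>merges\<close>; at the same end there is only one edge besides \<open>e\<close>.\<close>

lemma merges_inj:
  assumes "merges g e" "merges h e" shows "g = h"
proof -
  obtain x where x: "next_edge x g e" "pendant g" "\<And>z h. z \<noteq> x \<Longrightarrow> next_edge z e h \<Longrightarrow> \<not> pendant h"
    using assms by (auto simp: merges_def)
  obtain x' where x': "next_edge x' h e" "pendant h" using assms by (auto simp: merges_def)
  show ?thesis using x x' by (metis next_edge_sym next_edge_unique)
qed

text \<open>At most one edge is merged into \<open>a\<close>. A conflict inside the class of
  \<open>a\<close> would therefore join an edge to itself or \<open>a\<close> to the merged
  edge.\<close>

lemma rep_conflict_irrefl: "\<not> rep_conflict a a"
proof
  assume "rep_conflict a a"
  then obtain g h where gh: "conflict g h" "rep g = a" "rep h = a" by (auto simp: rep_conflict_def)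
  show False
    using rep_merges[OF gh(2)] rep_merges[OF gh(3)] gh(1)
    by (metis conflict_irrefl conflict_sym merges_conflict_False merges_inj)
qed

text \<open>The conflicts of \<open>a\<close> through its endpoint \<open>x\<close>, where the second disjunct covers the conflicts
  inherited from a pendant edge at \<open>x\<close> that is merged with \<open>a\<close>.\<close>

definition reach :: "'a set \<Rightarrow> 'a \<Rightarrow> 'a set \<Rightarrow> bool" where
  "reach a x h \<longleftrightarrow>
     (\<exists>m z. next_edge x a m \<and> next_edge z m h \<and> x \<noteq> z) \<or>
     (\<exists>g z. pendant g \<and> next_edge x g a \<and> next_edge z a h \<and> x \<noteq> z)"

text \<open>The two disjuncts of \<open>reach\<close> exclude each other: if the next edge at
  \<open>x\<close> is pendant, it cannot continue at its other end. Each disjunct alone determines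
  \<open>h\<close>.\<close>

lemma reach_unique:
  assumes "reach a x h" "reach a x h'" shows "h = h'"
proof -
  have False if "next_edge x a m" "next_edge z m h1" "x \<noteq> z" "pendant g" "next_edge x g a" for m z h1 g
  proof -
    have "g = m" using that by (metis next_edge_sym next_edge_unique)
    then show False using that by (metis pendant_next_unique(1) next_edge_sym)
  qed
  then show ?thesis
    using assms unfolding reach_def
    by (smt (verit, best) conflict_through_unique next_edge_mem edge_two next_edge_unique)
qed

text \<open>A conflict of an edge merged into \<open>a\<close> has \<open>a\<close> itself as its
  middle edge, which is the second disjunct of \<open>reach\<close>.\<close>

lemma rep_conflict_reach:
  assumes "rep_conflict a b"
  shows "\<exists>x h. x \<in> a \<and> reach a x h \<and> b = rep h"
proof -
  obtain g h where gh: "conflict g h" "rep g = a" "b = rep h"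
    using assms by (auto simp: rep_conflict_def)
  obtain x z m where c: "next_edge x g m" "next_edge z m h" "x \<noteq> z"
    using gh(1) by (auto simp: conflict_def)
  from rep_merges[OF gh(2)] show ?thesis
  proof
    assume "g = a"
    then show ?thesis using c gh(3) next_edge_mem unfolding reach_def by blast
  next
    assume "merges g a"
    then obtain x' where x': "next_edge x' g a" "pendant g" by (auto simp: merges_def)
    then have "x' = x" "a = m" using pendant_next_unique c(1) by blast+
    then show ?thesis using c x' gh(3) next_edge_mem unfolding reach_def by blast
  qed
qed

text \<open>Each of the two ends of \<open>a\<close> accounts for at most one conflict.\<close>

lemma rep_conflict_two:
  assumes "a \<in> E"
  shows "\<exists>b c. \<forall>f. rep_conflict a f \<longrightarrow> f = b \<or> f = c"
proof -
  obtain x z where "a = {x, z}" using card_E[OF assms] by (auto simp: card_2_iff)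
  then have "\<And>f. rep_conflict a f \<Longrightarrow> f = rep (THE h. reach a x h) \<or> f = rep (THE h. reach a z h)"
    using rep_conflict_reach reach_unique by (metis (no_types, lifting) insertE singletonD the_equality)
  then show ?thesis by blast
qed

lemma finite_star: "finite (star v)"
  using finite_E by (simp add: star_def)

lemma pendant_not_cubic:
  assumes "pendant g" "next_edge x g e" "v \<in> g"
  shows "card (star v) \<noteq> 3"
proof -
  obtain w where "w \<in> g" "card (star w) = 1" using assms(1) by (auto simp: pendant_def)
  moreover have "w \<noteq> x" using calculation assms(2) by (auto simp: next_edge_def)
  ultimately have "v = w \<or> v = x" using assms(2,3) by (metis edge_two next_edge_mem)
  then show ?thesis using \<open>card (star w) = 1\<close> next_edge_mem[OF assms(2)] by auto
qed

lemma rep_cubic: "v \<in> e \<Longrightarrow> card (star v) = 3 \<Longrightarrow> rep e = e"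
  using pendant_not_cubic by (cases e rule: rep_cases) (auto simp: merges_def)

lemma rep_mem: "e \<in> E \<Longrightarrow> rep e \<in> E"
  by (cases e rule: rep_cases) (auto simp: merges_def dest: next_edge_mem)

text \<open>Shows that merging does not interfere with conflicts at vertices of degree 3. The middle
  edge of a conflict of \<open>g\<close> is \<open>e\<close>, so both ends of \<open>e\<close> have
  degree 2.\<close>

lemma merges_conflict_not_cubic:
  assumes "merges g e" "conflict g h" "v \<in> e"
  shows "card (star v) \<noteq> 3"
proof -
  obtain x where x: "next_edge x g e" "pendant g" using assms by (auto simp: merges_def)
  obtain x' z m where c: "next_edge x' g m" "next_edge z m h" "x' \<noteq> z"
    using assms by (auto simp: conflict_def)
  have "x' = x" "m = e" using pendant_next_unique[OF x(2) c(1) x(1)] by auto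
  then have "v = x \<or> v = z" using c assms(3) by (metis edge_two next_edge_mem)
  then show ?thesis using next_edge_mem[OF c(2)] next_edge_mem[OF x(1)] by auto
qed

text \<open>Concerns a pendant edge \<open>g\<close> next to \<open>e\<close> that is not merged
  with it. Every way out of \<open>e\<close> leads to a pendant edge, whereas a middle edge has two
  ends of degree 2 and is never pendant.\<close>

lemma pendant_conflict_False:
  assumes "conflict e f" "next_edge x e g" "pendant g" "pendant e \<or> (\<exists>z h. z \<noteq> x \<and> next_edge z e h \<and> pendant h)"
  shows False
proof -
  obtain x' z' m where c: "next_edge x' e m" "next_edge z' m f" "x' \<noteq> z'"
    using assms(1) by (auto simp: conflict_def)
  have "\<not> pendant m" using c by (metis pendant_next_unique(1) next_edge_sym)
  then have "x' \<noteq> x" using assms(2,3) c(1) next_edge_unique by blast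
  then have "\<not> pendant e" using pendant_next_unique(1) assms(2) c(1) by blast
  then obtain z h where z: "z \<noteq> x" "next_edge z e h" "pendant h" using assms(4) by blast
  then have "x' = z" using \<open>x' \<noteq> x\<close> assms(2) c(1) by (metis edge_two next_edge_mem)
  then show False using z c(1) \<open>\<not> pendant m\<close> next_edge_unique by blast
qed

section \<open>Labelling all edges\<close>

definition cubic_edges :: "'a set set" where
  "cubic_edges = {e \<in> E. \<exists>v\<in>e. card (star v) = 3}"

text \<open>Representatives are labelled in two rounds: first the edges at vertices of degree 3 by
  \<open>star_labelling\<close>, then the remaining ones with conflicts greedily. Every other edge
  copies its representative.\<close>

lemma edge_labelling:
  obtains Y :: "'a set \<Rightarrow> int" where
    "\<And>e. e \<in> E \<Longrightarrow> Y e \<in> {-1,0,1}"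
    "\<And>e f. conflict e f \<Longrightarrow> Y e \<noteq> Y f"
    "\<And>x e g. next_edge x g e \<Longrightarrow> pendant g \<Longrightarrow> Y g = Y e \<or> Y e = 0"
    "\<And>v. card (star v) = 3 \<Longrightarrow> \<exists>s\<in>{1,-1}. (\<forall>e\<in>star v. Y e = s \<or> (Y e = 0 \<and> (\<exists>f\<in>cubic_edges. conflict e f))) \<and>
        (\<forall>e\<in>star v. \<forall>f\<in>star v. Y e = 0 \<longrightarrow> Y f = 0 \<longrightarrow> e = f)"
    "\<And>u x e c. card (star u) = 3 \<Longrightarrow> u \<in> e \<Longrightarrow> next_edge x e c \<Longrightarrow> Y e = 0 \<Longrightarrow> Y c = 0"
proof -
  define T where "T = {v \<in> \<Union>E. card (star v) = 3}"
  have T_iff: "v \<in> T \<longleftrightarrow> card (star v) = 3" for v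
  proof -
    have "star v \<noteq> {}" if "card (star v) = 3" using that by (metis card.empty zero_neq_numeral)
    then show ?thesis by (auto simp: T_def star_iff)
  qed
  have UT: "\<Union>(star ` T) = cubic_edges"
    by (auto simp: cubic_edges_def T_iff star_iff)
  have "finite (\<Union>E)" using finite_E card_E by (metis card.infinite finite_Union zero_neq_numeral)
  then have finT: "finite T" by (rule finite_subset[rotated]) (auto simp: T_def)
  have disj: "star v \<inter> star w = {}" if "v \<in> T" "w \<in> T" "v \<noteq> w" for v w
  proof -
    have "card (star v) = 3" "card (star w) = 3" using that T_iff by auto
    then show ?thesis using equal_degrees[of _ v w] that(3) by (auto simp: star_def)
  qed
  obtain y1 :: "'a set \<Rightarrow> int" where
    y1: "\<forall>v\<in>T. \<exists>s\<in>{1,-1}. (\<forall>e\<in>star v. y1 e = s \<or> (y1 e = 0 \<and> (\<exists>f\<in>cubic_edges. conflict e f))) \<and>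
        (\<forall>e\<in>star v. \<forall>f\<in>star v. y1 e = 0 \<longrightarrow> y1 f = 0 \<longrightarrow> e = f)"
    and y1c: "\<forall>e\<in>cubic_edges. \<forall>f\<in>cubic_edges. conflict e f \<longrightarrow> y1 e \<noteq> y1 f"
  proof -
    have card: "\<And>v. v \<in> T \<Longrightarrow> card (star v) = 3" by (simp add: T_iff)
    have unique: "\<And>v e f f'. v \<in> T \<Longrightarrow> e \<in> star v \<Longrightarrow> conflict e f \<Longrightarrow> conflict e f' \<Longrightarrow> f = f'"
      using conflict_unique_cubic unfolding T_iff star_iff by blast
    have "\<exists>y :: 'a set \<Rightarrow> int.
      (\<forall>v\<in>T. \<exists>s\<in>{1,-1}. (\<forall>e\<in>star v. y e = s \<or> (y e = 0 \<and> (\<exists>f\<in>cubic_edges. conflict e f))) \<and>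
        (\<forall>e\<in>star v. \<forall>f\<in>star v. y e = 0 \<longrightarrow> y f = 0 \<longrightarrow> e = f)) \<and>
      (\<forall>e\<in>cubic_edges. \<forall>f\<in>cubic_edges. conflict e f \<longrightarrow> y e \<noteq> y f)"
      unfolding UT[symmetric]
      by (rule star_labelling[OF finT]; (rule card disj conflict_sym conflict_irrefl unique)?; assumption?)
    then show ?thesis by (elim exE conjE) (rule that)
  qed
  \<comment> \<open>The default 0 matters: it remains on edges outside \<open>cubic_edges\<close>
    without conflicts, which gives the last conclusion and handles unmerged pendant edges.\<close>
  define y0 where "y0 e = (if e \<in> cubic_edges then y1 e else 0)" for e
  define F where "F = {e \<in> E - cubic_edges. \<exists>f. rep_conflict e f}"
  have finF: "finite F" using finite_E by (simp add: F_def)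
  obtain y where yn: "\<And>e. e \<notin> F \<Longrightarrow> y e = y0 e" and yF: "\<And>e. e \<in> F \<Longrightarrow> y e \<in> {-1,0,1}"
    and yc: "\<And>e f. e \<in> F \<Longrightarrow> rep_conflict e f \<Longrightarrow> y e \<noteq> y f"
  proof -
    have two: "\<And>e. e \<in> F \<Longrightarrow> \<exists>a b. \<forall>f. rep_conflict e f \<longrightarrow> f = a \<or> f = b"
      by (rule rep_conflict_two) (simp add: F_def)
    have "\<exists>y. (\<forall>e. e \<notin> F \<longrightarrow> y e = y0 e) \<and> (\<forall>e\<in>F. y e \<in> {-1,0,1}) \<and>
      (\<forall>e\<in>F. \<forall>f. rep_conflict e f \<longrightarrow> y e \<noteq> y f)"
      using finF rep_conflict_sym rep_conflict_irrefl two by (rule greedy_3_coloring_extension)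
    then obtain y where y: "\<forall>e. e \<notin> F \<longrightarrow> y e = y0 e" "\<forall>e\<in>F. y e \<in> {-1,0,1}"
      "\<forall>e\<in>F. \<forall>f. rep_conflict e f \<longrightarrow> y e \<noteq> y f"
      by (elim exE conjE) (rule that)
    show ?thesis by (rule that[of y]) (use y in \<open>simp_all only: simp_thms\<close>)
  qed
  define Y where "Y e = y (rep e)" for e
  have cub: "Y e = y1 e" if "e \<in> cubic_edges" for e
  proof -
    have "e \<notin> F" "rep e = e" using that rep_cubic by (auto simp: F_def cubic_edges_def)
    then show ?thesis using that yn by (simp add: Y_def y0_def)
  qed
  have zero: "Y c = 0" if "c \<notin> cubic_edges" "rep c = c" "\<And>f. \<not> rep_conflict c f" for c
    using that yn by (simp add: Y_def y0_def F_def)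
  show ?thesis
  proof (rule that[of Y])
    show "Y e \<in> {-1,0,1}" if "e \<in> E" for e
    proof (cases "rep e \<in> F")
      case True
      then show ?thesis using yF by (simp add: Y_def)
    next
      case False
      have "y0 (rep e) \<in> {-1,0,1}"
      proof (cases "rep e \<in> cubic_edges")
        case True
        then obtain v where "v \<in> T" "rep e \<in> star v" unfolding UT[symmetric] by blast
        then have "y1 (rep e) = 1 \<or> y1 (rep e) = -1 \<or> y1 (rep e) = 0" using y1 by blast
        then show ?thesis by (auto simp: y0_def)
      qed (simp add: y0_def)
      then show ?thesis using yn[OF False] by (simp add: Y_def)
    qed
    show "Y g \<noteq> Y h" if gh: "conflict g h" for g h
    proof -
      have rc: "rep_conflict (rep g) (rep h)" using gh by (auto simp: rep_conflict_def)
      consider "rep g \<in> F" | "rep h \<in> F" | "rep g \<in> cubic_edges" "rep h \<in> cubic_edges"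
        using rc rep_conflict_sym conflict_mem[OF gh] rep_mem unfolding F_def by blast
      then show ?thesis
      proof cases
        case 1
        then show ?thesis using yc[OF _ rc] by (simp add: Y_def)
      next
        case 2
        then show ?thesis using yc[OF _ rep_conflict_sym[OF rc]] by (simp add: Y_def)
      next
        case 3
        have "rep g = g" using 3(1) rep_merges[of g] merges_conflict_not_cubic[OF _ gh]
          unfolding cubic_edges_def by blast
        moreover have "rep h = h" using 3(2) rep_merges[of h] merges_conflict_not_cubic[OF _ conflict_sym[OF gh]]
          unfolding cubic_edges_def by blast
        ultimately show ?thesis using 3 y1c gh cub by simp
      qed
    qed
    show "Y g = Y e \<or> Y e = 0" if xg: "next_edge x g e" "pendant g" for x e g
    proof (cases "merges g e")
      case True
      then have "rep e = e" using rep_not_pendant by (auto simp: merges_def)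
      then show ?thesis using rep_eq[OF True] by (simp add: Y_def)
    next
      case False
      then have h: "pendant e \<or> (\<exists>z h. z \<noteq> x \<and> next_edge z e h \<and> pendant h)"
        using xg unfolding merges_def by blast
      note xe = next_edge_sym[OF xg(1)]
      have "Y e = 0"
      proof (rule zero)
        have "card (star v) \<noteq> 3" if v: "v \<in> e" for v
          using h
        proof
          assume "pendant e"
          then show ?thesis using pendant_not_cubic xe v by blast
        next
          assume "\<exists>z h. z \<noteq> x \<and> next_edge z e h \<and> pendant h"
          then obtain z h where z: "z \<noteq> x" "next_edge z e h" by blast
          then have "v = x \<or> v = z" using v xe by (metis edge_two next_edge_mem)
          then show ?thesis using next_edge_mem[OF z(2)] next_edge_mem[OF xe] by auto
        qed
        then show "e \<notin> cubic_edges" by (auto simp: cubic_edges_def)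
        have "\<not> merges e e'" for e'
          using xe xg(2) pendant_next_unique unfolding merges_def by blast
        then show "rep e = e" using rep_merges by blast
        \<comment> \<open>Such a \<open>g'\<close> would enter \<open>e\<close> at the end other
          than \<open>x\<close>, and then the pendant edge \<open>g\<close> violates the last clause
          of \<open>merges\<close>.\<close>
        have nm: "\<not> merges g' e" if "g' \<noteq> g" for g'
          using that h xe xg unfolding merges_def by (metis next_edge_sym next_edge_unique)
        show "\<not> rep_conflict e f" for f
        proof
          assume "rep_conflict e f"
          then obtain g' h' where "conflict g' h'" "rep g' = e" by (auto simp: rep_conflict_def)
          moreover have "\<not> merges g' e" using nm False by (cases "g' = g") simp_all
          ultimately have "conflict e h'" using rep_merges[of g' e] by metis
          then show False by (rule pendant_conflict_False[OF _ xe xg(2) h])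
        qed
      qed
      then show ?thesis ..
    qed
    show "\<exists>s\<in>{1,-1}. (\<forall>e\<in>star v. Y e = s \<or> (Y e = 0 \<and> (\<exists>f\<in>cubic_edges. conflict e f))) \<and>
        (\<forall>e\<in>star v. \<forall>f\<in>star v. Y e = 0 \<longrightarrow> Y f = 0 \<longrightarrow> e = f)" if v: "card (star v) = 3" for v
    proof -
      have "Y e = y1 e" if "e \<in> star v" for e
        using that v cub by (auto simp: cubic_edges_def star_iff)
      then show ?thesis using y1 v T_iff by simp
    qed
    show "Y c = 0" if u: "card (star u) = 3" "u \<in> e" "next_edge x e c" "Y e = 0" for u x e c
    proof -
      have eE: "e \<in> star u" "e \<in> cubic_edges"
        using u next_edge_mem by (auto simp: cubic_edges_def star_iff)
      \<comment> \<open>A zero at \<open>u\<close> comes with a conflict with another edge at a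
        vertex of degree 3. Its middle edge is \<open>c\<close>, because \<open>e\<close> can
        continue only through its end other than \<open>u\<close>.\<close>
      then obtain f where f: "f \<in> cubic_edges" "conflict e f"
        using y1 cub u T_iff by (metis insertE singletonD zero_neq_neg_one zero_neq_one)
      obtain x' z m where c: "next_edge x' e m" "next_edge z m f" "x' \<noteq> z"
        using f(2) by (auto simp: conflict_def)
      have xu: "x' \<noteq> u" "x \<noteq> u" using c(1) u by (auto simp: next_edge_def)
      then have "x' = x" using c(1) u by (metis edge_two next_edge_mem)
      then have mc: "m = c" using c(1) u(3) next_edge_unique by blast
      obtain w where w: "w \<in> f" "card (star w) = 3" using f(1) by (auto simp: cubic_edges_def)
      have zw: "z \<noteq> w" using c(2) w(2) by (auto simp: next_edge_def)
      have c2: "next_edge z c f" "x \<noteq> z" using c mc \<open>x' = x\<close> by auto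
      have cxz: "v = x \<or> v = z" if "v \<in> c" for v
        using that c2 u(3) by (metis edge_two next_edge_mem)
      then have two: "card (star v) = 2" if "v \<in> c" for v
        using that next_edge_mem[OF c2(1)] next_edge_mem[OF u(3)] by blast
      have ep: "\<not> pendant e" using pendant_not_cubic u(1-3) by blast
      have fp: "\<not> pendant f" using pendant_not_cubic w next_edge_sym[OF c2(1)] by blast
      show ?thesis
      proof (rule zero)
        show "c \<notin> cubic_edges" using two by (auto simp: cubic_edges_def)
        show "rep c = c" using two by (intro rep_not_pendant) (auto simp: pendant_def)
        have nxt: "a = e \<or> a = f" if "next_edge b c a" for a b
        proof -
          have "b = x \<or> b = z" using cxz next_edge_mem[OF that] by blast
          then show ?thesis using that c2(1) next_edge_sym[OF u(3)] next_edge_unique by blast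
        qed
        \<comment> \<open>A conflict of \<open>c\<close> would have \<open>e\<close> or
          \<open>f\<close> as its middle edge, but these have the ends \<open>u\<close> and
          \<open>w\<close> of degree 3.\<close>
        show "\<not> rep_conflict c b" for b
        proof
          assume "rep_conflict c b"
          then obtain g h where g: "conflict g h" "rep g = c" by (auto simp: rep_conflict_def)
          have "\<not> merges g c"
            using nxt ep fp next_edge_sym unfolding merges_def by blast
          then have "conflict c h" using rep_merges[OF g(2)] g(1) by blast
          then obtain x1 z1 m1 where k: "next_edge x1 c m1" "next_edge z1 m1 h" "x1 \<noteq> z1"
            by (auto simp: conflict_def)
          have z12: "card (star z1) = 2" "z1 \<in> m1" "x1 \<in> m1" "card (star x1) = 2" "m1 \<in> E"
            using next_edge_mem[OF k(1)] next_edge_mem[OF k(2)] by auto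
          have "card (star v) = 2" if "v \<in> m1" for v
            using z12 k(3) that edge_two by metis
          then have "card (star u) = 2 \<or> card (star w) = 2"
            using nxt[OF k(1)] u(2) w(1) by blast
          then show False using u(1) w(2) by simp
        qed
      qed
    qed
  qed
qed

section \<open>Comparing the degrees at the ends of an edge\<close>

lemma irregular_labelling:
  obtains Y :: "'a set \<Rightarrow> int" where
    "\<And>e. e \<in> E \<Longrightarrow> Y e \<in> {-1,0,1}"
    "\<And>e u v. e \<in> E \<Longrightarrow> u \<in> e \<Longrightarrow> v \<in> e \<Longrightarrow> u \<noteq> v \<Longrightarrow> 0 \<le> Y e \<Longrightarrow>
       (\<Sum>f\<in>star u. 1 + Y f) \<noteq> (\<Sum>f\<in>star v. 1 + Y f)"
    "\<And>e u v. e \<in> E \<Longrightarrow> u \<in> e \<Longrightarrow> v \<in> e \<Longrightarrow> u \<noteq> v \<Longrightarrow> Y e \<le> 0 \<Longrightarrow>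
       (\<Sum>f\<in>star u. 1 - Y f) \<noteq> (\<Sum>f\<in>star v. 1 - Y f)"
proof -
  obtain Y :: "'a set \<Rightarrow> int" where
    Y: "\<And>e. e \<in> E \<Longrightarrow> Y e \<in> {-1,0,1}"
    and Yc: "\<And>e f. conflict e f \<Longrightarrow> Y e \<noteq> Y f"
    and Yp: "\<And>x e g. next_edge x g e \<Longrightarrow> pendant g \<Longrightarrow> Y g = Y e \<or> Y e = 0"
    and Y3: "\<And>v. card (star v) = 3 \<Longrightarrow> \<exists>s\<in>{1,-1}. (\<forall>e\<in>star v. Y e = s \<or> (Y e = 0 \<and> (\<exists>f\<in>cubic_edges. conflict e f))) \<and>
        (\<forall>e\<in>star v. \<forall>f\<in>star v. Y e = 0 \<longrightarrow> Y f = 0 \<longrightarrow> e = f)"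
    and Y0: "\<And>u x e c. card (star u) = 3 \<Longrightarrow> u \<in> e \<Longrightarrow> next_edge x e c \<Longrightarrow> Y e = 0 \<Longrightarrow> Y c = 0"
    by (rule edge_labelling) (rule that)
  \<comment> \<open>These are the red and blue degrees. The sign conditions on \<open>Y e\<close>
    express that \<open>e\<close> has a copy of the respective color.\<close>
  let ?R = "\<lambda>u. \<Sum>f\<in>star u. 1 + Y f" and ?B = "\<lambda>u. \<Sum>f\<in>star u. 1 - Y f"
  have ordered: "(0 \<le> Y e \<longrightarrow> ?R u \<noteq> ?R v) \<and> (Y e \<le> 0 \<longrightarrow> ?B u \<noteq> ?B v)"
    if e: "e \<in> E" "u \<in> e" "v \<in> e" "u \<noteq> v" and le: "card (star u) \<le> card (star v)" for e u v
  proof -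
    have es: "e \<in> star u" "e \<in> star v" using e by (auto simp: star_iff)
    have pos: "card (star w) \<noteq> 0" if "e \<in> star w" for w using that finite_star[of w] by auto
    have max: "card (star v) \<le> 3" using degree_le[of v] by (simp add: star_def)
    have eq: "card (star u) = card (star v) \<Longrightarrow> card (star u) = 2"
      using equal_degrees[OF e] by (simp add: star_def)
    have two: "\<exists>f. next_edge w e f" if w: "e \<in> star w" "card (star w) = 2" for w
    proof -
      have "card (star w - {e}) = 1" using w by (simp add: card_Diff_singleton)
      then obtain f where "star w - {e} = {f}" by (rule card_1_singletonE)
      then have "next_edge w e f" using w by (auto simp: next_edge_def)
      then show ?thesis ..
    qed
    have three: "\<exists>a b. star v = {e, a, b} \<and> e \<noteq> a \<and> e \<noteq> b \<and> a \<noteq> b" if "card (star v) = 3"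
    proof -
      have "card (star v - {e}) = 2" using that es by (simp add: card_Diff_singleton)
      then obtain a b where "star v - {e} = {a, b}" "a \<noteq> b" by (auto simp: card_2_iff)
      then have "star v = {e, a, b} \<and> e \<noteq> a \<and> e \<noteq> b \<and> a \<noteq> b" using es by auto
      then show ?thesis by blast
    qed
    consider "card (star u) = 1" "card (star v) = 2" | "card (star u) = 2" "card (star v) = 2"
      | "card (star u) = 1" "card (star v) = 3" | "card (star u) = 2" "card (star v) = 3"
      using pos[OF es(1)] pos[OF es(2)] le max eq by linarith
    then show ?thesis
    proof cases
      case 1
      obtain f where f: "next_edge v e f" using two es 1 by blast
      have "star u = {e}" using 1(1) es(1) by (auto simp: card_1_singleton_iff)
      moreover have "star v = {e, f}" "e \<noteq> f" using star_next_edge[OF f] next_edge_mem[OF f] by auto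
      \<comment> \<open>The red degrees agree only for \<open>Y f = -1\<close>; then
        \<open>Y e = -1\<close> and \<open>e\<close> has no red copy. Blue is symmetric.\<close>
      moreover have "Y e = Y f \<or> Y f = 0" using Yp[OF f] 1(1) e(2) by (auto simp: pendant_def)
      ultimately show ?thesis by auto
    next
      case 2
      obtain f where f: "next_edge u e f" using two es 2 by blast
      obtain g where g: "next_edge v e g" using two es 2 by blast
      have "conflict f g" unfolding conflict_def using next_edge_sym[OF f] g e(4) by blast
      then have "Y f \<noteq> Y g" by (rule Yc)
      then show ?thesis
        using star_next_edge[OF f] next_edge_mem[OF f] star_next_edge[OF g] next_edge_mem[OF g] by auto
    next
      case 3
      obtain a b where ab: "star v = {e, a, b}" "e \<noteq> a" "e \<noteq> b" "a \<noteq> b" using three 3 by blast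
      \<comment> \<open>Without a conflict, \<open>e\<close> has the label \<open>s\<close>. The red
        degrees agree only if \<open>Y a = Y b = -1\<close>, hence \<open>s = -1\<close>, and then
        \<open>e\<close> has no red copy.\<close>
      have "\<not> conflict e f" for f
      proof
        assume "conflict e f"
        then obtain x m where "next_edge x e m" by (auto simp: conflict_def)
        then show False using pendant_not_cubic[of e x m v] 3 e(2,3) by (auto simp: pendant_def)
      qed
      moreover obtain s where s: "s \<in> {1,-1}"
        "\<forall>e\<in>star v. Y e = s \<or> (Y e = 0 \<and> (\<exists>f\<in>cubic_edges. conflict e f))"
        using Y3[OF 3(2)] by (elim bexE conjE) (rule that)
      ultimately have "Y e = s" using es(2) by blast
      moreover have "Y a = s \<or> Y a = 0" "Y b = s \<or> Y b = 0"
        using bspec[OF s(2), of a] bspec[OF s(2), of b] ab(1) by blast+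
      moreover have "star u = {e}" using 3(1) es(1) by (auto simp: card_1_singleton_iff)
      then have "?R u = 1 + Y e" "?B u = 1 - Y e" by simp_all
      moreover have "?R v = 3 + Y e + Y a + Y b" "?B v = 3 - Y e - Y a - Y b"
        using ab(2-4) unfolding ab(1) by simp_all
      ultimately show ?thesis using s(1) by auto
    next
      case 4
      obtain a b where ab: "star v = {e, a, b}" "e \<noteq> a" "e \<noteq> b" "a \<noteq> b" using three 4 by blast
      obtain c where c: "next_edge u e c" using two es 4 by blast
      have u: "star u = {e, c}" "e \<noteq> c" using star_next_edge[OF c] next_edge_mem[OF c] by auto
      obtain s where s: "s \<in> {1,-1}"
        "\<forall>f\<in>star v. Y f = s \<or> (Y f = 0 \<and> (\<exists>g\<in>cubic_edges. conflict f g))"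
        "\<forall>f\<in>star v. \<forall>g\<in>star v. Y f = 0 \<longrightarrow> Y g = 0 \<longrightarrow> f = g"
        using Y3[OF 4(2)] by (elim bexE conjE) (rule that)
      have mem: "e \<in> star v" "a \<in> star v" "b \<in> star v" using ab(1) by simp_all
      then have "Y e = s \<or> Y e = 0" "Y a = s \<or> Y a = 0" "Y b = s \<or> Y b = 0"
        using s(2) by blast+
      moreover have "Y e \<noteq> 0 \<or> Y a \<noteq> 0" "Y e \<noteq> 0 \<or> Y b \<noteq> 0" "Y a \<noteq> 0 \<or> Y b \<noteq> 0"
        using s(3) mem ab(2-4) by blast+
      moreover have "Y c = -1 \<or> Y c = 0 \<or> Y c = 1" using Y[of c] next_edge_mem[OF c] by simp
      \<comment> \<open>The critical case: for \<open>s = 1\<close> and \<open>Y e = 0\<close>, both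
        \<open>a\<close> and \<open>b\<close> have the label 1, and the blue degrees agree exactly
        if \<open>Y c = 1\<close>. The case \<open>s = -1\<close> is symmetric.\<close>
      moreover have "Y e = 0 \<longrightarrow> Y c = 0" using Y0[OF 4(2) e(3) c] ..
      moreover have "s = 1 \<or> s = -1" using s(1) by simp
      moreover have "?R u = 2 + Y e + Y c" "?B u = 2 - Y e - Y c"
        using u(2) unfolding u(1) by simp_all
      moreover have "?R v = 3 + Y e + Y a + Y b" "?B v = 3 - Y e - Y a - Y b"
        using ab(2-4) unfolding ab(1) by simp_all
      ultimately show ?thesis by presburger
    qed
  qed
  show ?thesis
  proof (rule that[of Y])
    show "?R u \<noteq> ?R v" if "e \<in> E" "u \<in> e" "v \<in> e" "u \<noteq> v" "0 \<le> Y e" for e u v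
      using ordered[of e u v] ordered[of e v u] that by (metis nle_le)
    show "?B u \<noteq> ?B v" if "e \<in> E" "u \<in> e" "v \<in> e" "u \<noteq> v" "Y e \<le> 0" for e u v
      using ordered[of e u v] ordered[of e v u] that by (metis nle_le)
  qed (rule Y)
qed

end

section \<open>From labels to colors\<close>

lemma count_color_submultigraph_double:
  assumes "finite (edges G)"
  shows "count (medges (color_submultigraph (double G) c k)) e =
    (if e \<in> edges G then card {i \<in> {..<2}. c (e, i) = k} else 0)"
proof -
  have cnt: "count (medges (double G)) f = (if f \<in> edges G then 2 else 0)" for f
    using assms by (simp add: double_def count_mset_set')
  have set: "set_mset (medges (double G)) = edges G"
    by (intro set_eqI) (simp flip: count_greater_zero_iff add: cnt)
  have copies: "edge_copies (double G) = edges G \<times> {..<2}"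
    by (auto simp: edge_copies_def set cnt)
  let ?A = "{x \<in> edges G \<times> {..<2}. c x = k}"
  have fin: "finite ?A" using assms by simp
  have "count (medges (color_submultigraph (double G) c k)) e = card {x \<in> ?A. fst x = e}"
    using fin by (simp add: color_submultigraph_def copies Let_def count_image_mset vimage_def Int_def conj_commute)
  also have "{x \<in> ?A. fst x = e} = (if e \<in> edges G then Pair e ` {i \<in> {..<2}. c (e, i) = k} else {})"
    by auto
  also have "card \<dots> = (if e \<in> edges G then card {i \<in> {..<2}. c (e, i) = k} else 0)"
    by (simp add: card_image inj_on_def)
  finally show ?thesis .
qed

theorem theorem14:
  fixes G :: "'a sgraph"
  assumes "simple_graph G"
    and "connected_graph G"
    and "subcubic G"
    and "\<not> is_complete_graph 2 G"
    and "independent_set G {v \<in> verts G. degree G v = 3}"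
  shows "lir (double G) \<le> 2"
proof -
  let ?E = "edges G"
  have finV: "finite (verts G)" and sub: "\<And>e. e \<in> ?E \<Longrightarrow> e \<subseteq> verts G"
    and card2: "\<And>e. e \<in> ?E \<Longrightarrow> card e = 2"
    using assms(1) by (auto simp: simple_graph_def)
  have finE: "finite ?E" using finV sub by (meson Pow_iff finite_Pow_iff finite_subset subsetI)
  have deg3: "card {e \<in> ?E. v \<in> e} \<le> 3" for v
  proof (cases "v \<in> verts G")
    case True
    then have "degree G v \<le> max_degree G" using finV by (simp add: max_degree_def)
    then show ?thesis using assms(3) by (simp add: subcubic_def degree_def)
  next
    case False
    then have "{e \<in> ?E. v \<in> e} = {}" using sub by blast
    then show ?thesis by (metis card.empty le0)
  qed
  have edge: "e = {u, v}" if "e \<in> ?E" "u \<in> e" "v \<in> e" "u \<noteq> v" for e u v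
    using card2[OF that(1)] that(2-4) by (auto simp: card_2_iff)
  have degrees: "card {e \<in> ?E. u \<in> e} = 2"
    if e: "e \<in> ?E" "u \<in> e" "v \<in> e" "u \<noteq> v" and eq: "card {e \<in> ?E. u \<in> e} = card {e \<in> ?E. v \<in> e}" for e u v
  proof -
    have uv: "e = {u, v}" "u \<in> verts G" "v \<in> verts G" using edge e sub by blast+
    have "card {e \<in> ?E. u \<in> e} \<noteq> 0" using e finE by auto
    moreover have "card {e \<in> ?E. u \<in> e} \<noteq> 3"
    proof
      assume "card {e \<in> ?E. u \<in> e} = 3"
      then have "degree G u = 3" "degree G v = 3" using eq by (simp_all add: degree_def)
      then have "{u, v} \<notin> ?E" using assms(5) uv by (simp add: independent_set_def)
      then show False using e uv by simp
    qed
    \<comment> \<open>If both ends had degree 1, \<open>e\<close> would form a component, and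
      connectedness would make the graph complete on two vertices.\<close>
    moreover have "card {e \<in> ?E. u \<in> e} \<noteq> 1"
    proof
      assume one: "card {e \<in> ?E. u \<in> e} = 1"
      have single: "f = e" if w: "card {g \<in> ?E. w \<in> g} = 1" "w \<in> e" "f \<in> ?E" "w \<in> f" for f w
      proof -
        obtain g where "{g \<in> ?E. w \<in> g} = {g}" by (rule card_1_singletonE[OF w(1)])
        moreover have "e \<in> {g \<in> ?E. w \<in> g}" "f \<in> {g \<in> ?E. w \<in> g}" using w e(1) by simp_all
        ultimately show ?thesis by (simp only: singleton_iff)
      qed
      have only: "f = e" if "f \<in> ?E" "u \<in> f \<or> v \<in> f" for f
        using that single[OF one e(2)] single[OF one[unfolded eq] e(3)] by blast
      have "w \<in> e" if "w \<in> verts G" for w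
      proof -
        have "(u, w) \<in> {(x, y). {x, y} \<in> ?E}\<^sup>*"
          using assms(2) uv(2) that by (simp add: connected_graph_def)
        then show ?thesis
        proof (induction rule: rtrancl_induct)
          case (step x y)
          then have "{x, y} = e" using only[of "{x, y}"] uv(1) by auto
          then show ?case by blast
        qed (rule e(2))
      qed
      then have V: "verts G = {u, v}" using sub[OF e(1)] uv(1) by blast
      have "?E = {f. f \<subseteq> verts G \<and> card f = 2}"
      proof
        show "{f. f \<subseteq> verts G \<and> card f = 2} \<subseteq> ?E"
        proof
          fix f assume "f \<in> {f. f \<subseteq> verts G \<and> card f = 2}"
          then have "f = verts G" using V e(4) by (intro card_subset_eq) auto
          then show "f \<in> ?E" using V uv(1) e(1) by simp
        qed
      qed (use sub card2 in blast)
      then show False using assms(4) V e(4) by (simp add: is_complete_graph_def)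
    qed
    ultimately show ?thesis using deg3[of u] by linarith
  qed
  interpret independent_cubic ?E
    by unfold_locales (fact finE, fact card2, fact deg3, fact degrees)
  obtain Y :: "'a set \<Rightarrow> int" where
    Y: "\<And>e. e \<in> ?E \<Longrightarrow> Y e \<in> {-1,0,1}"
    and Y0: "\<And>e u v. e \<in> ?E \<Longrightarrow> u \<in> e \<Longrightarrow> v \<in> e \<Longrightarrow> u \<noteq> v \<Longrightarrow> 0 \<le> Y e \<Longrightarrow>
       (\<Sum>f\<in>star u. 1 + Y f) \<noteq> (\<Sum>f\<in>star v. 1 + Y f)"
    and Y1: "\<And>e u v. e \<in> ?E \<Longrightarrow> u \<in> e \<Longrightarrow> v \<in> e \<Longrightarrow> u \<noteq> v \<Longrightarrow> Y e \<le> 0 \<Longrightarrow>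
       (\<Sum>f\<in>star u. 1 - Y f) \<noteq> (\<Sum>f\<in>star v. 1 - Y f)"
    by (rule irregular_labelling) (rule that)
  \<comment> \<open>Color 0 is red and color 1 is blue. The copies have indices 0 and 1, so exactly
    \<open>1 + Y e\<close> of them become red.\<close>
  define c :: "'a set \<times> nat \<Rightarrow> nat" where
    "c = (\<lambda>(e, i). if int i < 1 + Y e then 0 else 1)"
  let ?M = "color_submultigraph (double G) c"
  have cnt0: "int (count (medges (?M 0)) e) = 1 + Y e" if "e \<in> ?E" for e
  proof -
    have "{i \<in> {..<2}. c (e, i) = 0} = {..<nat (1 + Y e)}"
      using Y[OF that] by (auto simp: c_def)
    then have "count (medges (?M 0)) e = nat (1 + Y e)"
      using that by (simp only: count_color_submultigraph_double[OF finE] if_True card_lessThan)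
    moreover have "Y e = -1 \<or> Y e = 0 \<or> Y e = 1" using Y[OF that] by simp
    ultimately show ?thesis by (elim disjE) simp_all
  qed
  have cnt1: "int (count (medges (?M 1)) e) = 1 - Y e" if "e \<in> ?E" for e
  proof -
    have "{i \<in> {..<2}. c (e, i) = 1} = {nat (1 + Y e)..<2}"
      by (intro set_eqI) (simp add: c_def nat_le_iff not_less conj_commute)
    then have "count (medges (?M 1)) e = 2 - nat (1 + Y e)"
      using that by (simp only: count_color_submultigraph_double[OF finE] if_True card_atLeastLessThan)
    moreover have "Y e = -1 \<or> Y e = 0 \<or> Y e = 1" using Y[OF that] by simp
    ultimately show ?thesis by (elim disjE) simp_all
  qed
  have mem: "e \<in> ?E" if "e \<in># medges (?M k)" for e k
    using that count_color_submultigraph_double[OF finE, of c k e] by (auto simp flip: count_greater_zero_iff split: if_splits)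
  have mdeg: "mdegree (?M k) v = (\<Sum>e\<in>star v. count (medges (?M k)) e)" for k v
    unfolding mdegree_def
    by (rule sum.mono_neutral_left) (auto simp: finite_star star_iff mem simp flip: not_in_iff)
  have mdeg0: "int (mdegree (?M 0) v) = (\<Sum>f\<in>star v. 1 + Y f)" for v
    by (simp add: mdeg star_iff cnt0 cong: sum.cong_simp)
  have mdeg1: "int (mdegree (?M 1) v) = (\<Sum>f\<in>star v. 1 - Y f)" for v
    by (simp add: mdeg star_iff cnt1[simplified] cong: sum.cong_simp)
  have ne: "u \<noteq> v" if "{u, v} \<in> ?E" for u v using card2[OF that] by auto
  have irr0: "locally_irregular (?M 0)"
    unfolding locally_irregular_def
  proof (intro ballI impI)
    fix u v assume uv: "{u, v} \<in># medges (?M 0)"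
    then have "0 \<le> Y {u, v}" using cnt0[OF mem[OF uv]] by (simp flip: count_greater_zero_iff)
    then show "mdegree (?M 0) u \<noteq> mdegree (?M 0) v"
      using Y0[OF mem[OF uv], of u v] ne[OF mem[OF uv]] mdeg0 by (metis insertI1 insertI2)
  qed
  have irr1: "locally_irregular (?M 1)"
    unfolding locally_irregular_def
  proof (intro ballI impI)
    fix u v assume uv: "{u, v} \<in># medges (?M 1)"
    then have "Y {u, v} \<le> 0" using cnt1[OF mem[OF uv]] by (simp flip: count_greater_zero_iff)
    then show "mdegree (?M 1) u \<noteq> mdegree (?M 1) v"
      using Y1[OF mem[OF uv], of u v] ne[OF mem[OF uv]] mdeg1 by (metis insertI1 insertI2)
  qed
  have col: "colors_used (double G) c \<subseteq> {0, 1}"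
    by (auto simp: colors_used_def c_def)
  then have "locally_irregular_coloring (double G) c"
    using irr0 irr1 unfolding locally_irregular_coloring_def by blast
  moreover have "card (colors_used (double G) c) \<le> 2"
    using card_mono[OF _ col] by simp
  ultimately have "lir (double G) \<le> enat 2" using lir_le_iff by blast
  then show ?thesis by (simp add: numeral_eq_enat)
qed

end
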